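(* Let $(\mathscr{C},\mathbb{E},\mathfrak{s})$ be an $n$-exangulated category with enough projective morphisms. Then an ideal $\mathfrak{I}$ of $\mathscr{C}$ is special precovering if there exists an additive subfunctor $\mathbb{F}\subseteq\mathbb{E}$ with enough injective morphisms such that $\mathfrak{I}=\mathbf{Ph}(\mathbb{F})$.
   Context: **$n$-exangulated categories.** Let $n\ge 1$, let $\mathscr{C}$ be an additive category and $\mathbb{E}:\mathscr{C}^{op}\times\mathscr{C}\to\mathsf{Ab}$ a biadditive functor. An element $\delta\in\mathbb{E}(C,A)$ is called an extension; for $a:A\to A'$ and $c:C'\to C$ write $a_*\delta=\mathbb{E}(C,a)(\delta)$ and $c^*\delta=\mathbb{E}(c,A)(\delta)$. A morphism of extensions $(a,c):\delta\to\delta'$ (with $\delta\in\mathbb{E}(C,A)$, $\delta'\in\mathbb{E}(C',A')$) is a pair $a:A\to A'$, $c:C\to C'$ with $a_*\delta=c^*\delta'$. Consider complexes $X^\bullet: X_0\xrightarrow{d_X^0}X_1\to\cdots\to X_n\xrightarrow{d_X^n}X_{n+1}$ in $\mathscr{C}$. A pair $\langle X^\bullet,\delta\rangle$ with $\delta\in\mathbb{E}(X_{n+1},X_0)$ is an $n$-exangle if for every object $W$ the sequences $\mathscr{C}(W,X_0)\to\cdots\to\mathscr{C}(W,X_{n+1})\to\mathbb{E}(W,X_0)$ (last map $f\mapsto f^*\delta$) and $\mathscr{C}(X_{n+1},W)\to\cdots\to\mathscr{C}(X_0,W)\to\mathbb{E}(X_{n+1},W)$ (last map $g\mapsto g_*\delta$)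 are exact. A morphism of $n$-exangles $\langle X^\bullet,\delta\rangle\to\langle Y^\bullet,\rho\rangle$ is a chain map $f^\bullet=(f^0,\dots,f^{n+1})$ with $(f^0)_*\delta=(f^{n+1})^*\rho$. For fixed ends $X_0=A$, $X_{n+1}=C$, one considers chain maps that are identities at both ends; two such $f,g:X^\bullet\to Y^\bullet$ are homotopic if there are $\varphi^i:X_i\to Y_{i-1}$ ($1\le i\le n+1$) with $\varphi^1d_X^0=0$, $g^i-f^i=d_Y^{i-1}\varphi^i+\varphi^{i+1}d_X^i$ ($1\le i\le n$), $d_Y^n\varphi^{n+1}=0$; this gives homotopy equivalence classes $[X^\bullet]$. An exact realization $\mathfrak{s}$ assigns to each $\delta\in\mathbb{E}(C,A)$ such a class $\mathfrak{s}(\delta)=[X^\bullet]$ with ends $A,C$, such that: (R0) if $\mathfrak{s}(\delta)=[X^\bullet]$, $\mathfrak{s}(\rho)=[Y^\bullet]$, every morphism of extensions $(a,c):\delta\to\rho$ lifts to a chain map $(a,f^1,\dots,f^n,c):X^\bullet\to Y^\bullet$; (R1) if $\mathfrak{s}(\delta)=[X^\bullet]$ then $\langle X^\bullet,\delta\rangle$ is an $n$-exangle; (R2) $\mathfrak{s}$ sends $0\in\mathbb{E}(0,A)$ to $[A\xrightarrow{1}A\to0\to\cdots\to0]$ and $0\in\mathbb{E}(A,0)$ to $[0\to\cdots\to0\to A\xrightarrow{1}A]$. If $\mathfrak{s}(\delta)=[X^\bullet]$, then $\langle X^\bullet,\delta\rangle$ is called a distinguished $n$-exangle, $X^\bullet$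 is said to realize $\delta$, $d_X^0$ is called an inflation and $d_X^n$ a deflation. $(\mathscr{C},\mathbb{E},\mathfrak{s})$ is an $n$-exangulated category if $\mathfrak{s}$ is an exact realization and: (EA1) inflations are closed under composition, and so are deflations; (EA2) for $\rho\in\mathbb{E}(D,A)$, $c:C\to D$ and distinguished $\langle X^\bullet,c^*\rho\rangle$, $\langle Y^\bullet,\rho\rangle$, the morphism $(1_A,c)$ has a lift $f^\bullet$ whose mapping cone $X_1\to X_2\oplus Y_1\to\cdots\to X_{n+1}\oplus Y_n\to Y_{n+1}$ (differentials $\begin{bmatrix}-d_X^1\\ f^1\end{bmatrix}$, $\begin{bmatrix}-d_X^{i+1}&0\\ f^{i+1}&d_Y^i\end{bmatrix}$, $\begin{bmatrix}f^{n+1}&d_Y^n\end{bmatrix}$) together with $(d_X^0)_*\rho$ is a distinguished $n$-exangle; (EA2$^{op}$) the dual of (EA2). **Ideals.** An ideal $\mathfrak{I}$ of $\mathscr{C}$ is a two-sided ideal of morphisms (subgroups $\mathfrak{I}(A,B)\subseteq\mathscr{C}(A,B)$ closed under composition with arbitrary morphisms on both sides). For $m:X\to C$, $g:A\to B$, $\mathbb{E}(m,g):\mathbb{E}(C,A)\to\mathbb{E}(X,B)$ is $\delta\mapsto g_*m^*\delta$, and $\mathfrak{I}^\perp=\{g:\mathbb{E}(m,g)=0\ \forall m\in\mathfrak{I}\}$. A morphism $i:Y_n\to C$ in $\mathfrak{I}$ is a special $\mathfrak{I}$-precover of $C$ if there are $\delta\in\mathbb{E}(C,A)$ and $j:A\to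 A'$ in $\mathfrak{I}^\perp$ and a distinguished $n$-exangle $\langle Y^\bullet,j_*\delta\rangle$ (ends $A',C$) with $d_Y^n=i$; $\mathfrak{I}$ is special precovering if every object has a special $\mathfrak{I}$-precover. **Subfunctors and phantoms.** An additive subfunctor $\mathbb{F}\subseteq\mathbb{E}$ consists of subgroups $\mathbb{F}(C,A)\subseteq\mathbb{E}(C,A)$ stable under all $a_*$ and $c^*$. $\mathbf{Ph}(\mathbb{F})$ is the ideal of all $\phi:X\to C$ such that $\phi^*\delta\in\mathbb{F}(X,A)$ for all $A$ and all $\delta\in\mathbb{E}(C,A)$ ($n$-$\mathbb{F}$-phantom morphisms). A morphism $g:A\to B$ is $\mathbb{F}$-injective if $g_*\delta=0$ for all $C$ and all $\delta\in\mathbb{F}(C,A)$; the ideal of these is $\mathbb{F}\text{-}\mathbf{inj}$. $\mathbb{F}$ has enough injective morphisms if for every object $A$ there is a distinguished $n$-exangle $\langle X^\bullet,\delta\rangle$ with $X_0=A$, $\delta\in\mathbb{F}(X_{n+1},A)$ and $d_X^0\in\mathbb{F}\text{-}\mathbf{inj}$. A morphism $p:P\to A$ is projective if $p^*\eta=0$ for all $B$ and all $\eta\in\mathbb{E}(A,B)$; $\mathscr{C}$ has enough projective morphisms if for every object $A$ there is a distinguished $n$-exangle $K\to P_1\to\cdots\to P_n\xrightarrow{p}A\dashrightarrow$ with $p$ a projective morphism. *)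

theory Defs
  imports "HOL-Algebra.Coset"
begin

section \<open>Additive categories\<close>

text \<open>
  The abelian groups \<open>Hom A B\<close> (and \<open>Ext C A\<close> below) are values of the HOL-Algebra record type
  \<open>monoid\<close>; their addition is therefore written multiplicatively: \<open>\<otimes>\<close> is \<open>+\<close>, \<open>\<one>\<close> is \<open>0\<close>, \<open>inv\<close>
  is \<open>-\<close>. The composite of \<open>f : A \<rightarrow> B\<close> and \<open>g : B \<rightarrow> D\<close> is \<open>g \<cdot> f\<close>.
\<close>

record ('o, 'm) addcat =
  Obj :: "'o set"
  Hom :: "'o \<Rightarrow> 'o \<Rightarrow> 'm monoid"
  Idm :: "'o \<Rightarrow> 'm"
  Cmp :: "'m \<Rightarrow> 'm \<Rightarrow> 'm" (infixr "\<cdot>\<index>" 75)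

definition zero_object :: "('o, 'm, 'z) addcat_scheme \<Rightarrow> 'o \<Rightarrow> bool" where
  "zero_object K Z \<longleftrightarrow> Z \<in> Obj K \<and>
     (\<forall>A\<in>Obj K. (\<exists>!f. f \<in> carrier (Hom K A Z)) \<and> (\<exists>!f. f \<in> carrier (Hom K Z A)))"

definition biproduct ::
  "('o, 'm, 'z) addcat_scheme \<Rightarrow> 'o \<Rightarrow> 'o \<Rightarrow> 'o \<Rightarrow> 'm \<Rightarrow> 'm \<Rightarrow> 'm \<Rightarrow> 'm \<Rightarrow> bool" where
  "biproduct K A B S i1 i2 p1 p2 \<longleftrightarrow>
     A \<in> Obj K \<and> B \<in> Obj K \<and> S \<in> Obj K \<and>
     i1 \<in> carrier (Hom K A S) \<and> i2 \<in> carrier (Hom K B S) \<and>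
     p1 \<in> carrier (Hom K S A) \<and> p2 \<in> carrier (Hom K S B) \<and>
     p1 \<cdot>\<^bsub>K\<^esub> i1 = Idm K A \<and> p2 \<cdot>\<^bsub>K\<^esub> i2 = Idm K B \<and>
     p1 \<cdot>\<^bsub>K\<^esub> i2 = \<one>\<^bsub>Hom K B A\<^esub> \<and> p2 \<cdot>\<^bsub>K\<^esub> i1 = \<one>\<^bsub>Hom K A B\<^esub> \<and>
     (i1 \<cdot>\<^bsub>K\<^esub> p1) \<otimes>\<^bsub>Hom K S S\<^esub> (i2 \<cdot>\<^bsub>K\<^esub> p2) = Idm K S"

locale additive_category =
  fixes K :: "('o, 'm, 'z) addcat_scheme" (structure)
  assumes hom_disjoint:
      "\<lbrakk>A \<in> Obj K; B \<in> Obj K; A' \<in> Obj K; B' \<in> Obj K;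
        f \<in> carrier (Hom K A B); f \<in> carrier (Hom K A' B')\<rbrakk> \<Longrightarrow> A = A' \<and> B = B'"
    and id_closed: "A \<in> Obj K \<Longrightarrow> Idm K A \<in> carrier (Hom K A A)"
    and comp_closed:
      "\<lbrakk>A \<in> Obj K; B \<in> Obj K; D \<in> Obj K; f \<in> carrier (Hom K A B); g \<in> carrier (Hom K B D)\<rbrakk>
       \<Longrightarrow> g \<cdot> f \<in> carrier (Hom K A D)"
    and id_left:
      "\<lbrakk>A \<in> Obj K; B \<in> Obj K; f \<in> carrier (Hom K A B)\<rbrakk> \<Longrightarrow> Idm K B \<cdot> f = f"
    and id_right:
      "\<lbrakk>A \<in> Obj K; B \<in> Obj K; f \<in> carrier (Hom K A B)\<rbrakk> \<Longrightarrow> f \<cdot> Idm K A = f"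
    and comp_assoc:
      "\<lbrakk>A \<in> Obj K; B \<in> Obj K; D \<in> Obj K; E \<in> Obj K;
        f \<in> carrier (Hom K A B); g \<in> carrier (Hom K B D); h \<in> carrier (Hom K D E)\<rbrakk>
       \<Longrightarrow> (h \<cdot> g) \<cdot> f = h \<cdot> (g \<cdot> f)"
    and hom_comm_group: "\<lbrakk>A \<in> Obj K; B \<in> Obj K\<rbrakk> \<Longrightarrow> comm_group (Hom K A B)"
    and comp_add_right:
      "\<lbrakk>A \<in> Obj K; B \<in> Obj K; D \<in> Obj K;
        f \<in> carrier (Hom K A B); f' \<in> carrier (Hom K A B); g \<in> carrier (Hom K B D)\<rbrakk>
       \<Longrightarrow> g \<cdot> (f \<otimes>\<^bsub>Hom K A B\<^esub> f') = (g \<cdot> f) \<otimes>\<^bsub>Hom K A D\<^esub> (g \<cdot> f')"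
    and comp_add_left:
      "\<lbrakk>A \<in> Obj K; B \<in> Obj K; D \<in> Obj K;
        f \<in> carrier (Hom K A B); g \<in> carrier (Hom K B D); g' \<in> carrier (Hom K B D)\<rbrakk>
       \<Longrightarrow> (g \<otimes>\<^bsub>Hom K B D\<^esub> g') \<cdot> f = (g \<cdot> f) \<otimes>\<^bsub>Hom K A D\<^esub> (g' \<cdot> f)"
    and zero_object_exists: "\<exists>Z. zero_object K Z"
    and biproduct_exists:
      "\<lbrakk>A \<in> Obj K; B \<in> Obj K\<rbrakk> \<Longrightarrow> \<exists>S i1 i2 p1 p2. biproduct K A B S i1 i2 p1 p2"


section \<open>Complexes with \<open>n + 2\<close> terms\<close>

text \<open>
  In a complex \<open>X\<^sub>0 \<rightarrow> \<dots> \<rightarrow> X\<^sub>n\<^sub>+\<^sub>1\<close> only the objects with index \<open>\<le> n + 1\<close> and the differentials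
  with index \<open>\<le> n\<close> are meaningful. All notions below ignore the remaining values; in particular
  complexes that differ only there are homotopy equivalent, so they lie in the same class.
\<close>

record ('o, 'm) cpx =
  Tm :: "nat \<Rightarrow> 'o"
  Df :: "nat \<Rightarrow> 'm"

definition is_complex :: "nat \<Rightarrow> ('o, 'm, 'z) addcat_scheme \<Rightarrow> ('o, 'm) cpx \<Rightarrow> bool" where
  "is_complex n K X \<longleftrightarrow>
     (\<forall>i\<le>n + 1. Tm X i \<in> Obj K) \<and>
     (\<forall>i\<le>n. Df X i \<in> carrier (Hom K (Tm X i) (Tm X (i + 1)))) \<and>
     (\<forall>i<n. Df X (i + 1) \<cdot>\<^bsub>K\<^esub> Df X i = \<one>\<^bsub>Hom K (Tm X i) (Tm X (i + 2))\<^esub>)"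

definition chain_map ::
  "nat \<Rightarrow> ('o, 'm, 'z) addcat_scheme \<Rightarrow> ('o, 'm) cpx \<Rightarrow> ('o, 'm) cpx \<Rightarrow> (nat \<Rightarrow> 'm) \<Rightarrow> bool" where
  "chain_map n K X Y f \<longleftrightarrow>
     (\<forall>i\<le>n + 1. f i \<in> carrier (Hom K (Tm X i) (Tm Y i))) \<and>
     (\<forall>i\<le>n. f (i + 1) \<cdot>\<^bsub>K\<^esub> Df X i = Df Y i \<cdot>\<^bsub>K\<^esub> f i)"

definition same_ends :: "nat \<Rightarrow> ('o, 'm) cpx \<Rightarrow> ('o, 'm) cpx \<Rightarrow> bool" where
  "same_ends n X Y \<longleftrightarrow> Tm X 0 = Tm Y 0 \<and> Tm X (n + 1) = Tm Y (n + 1)"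

definition end_fixing_map ::
  "nat \<Rightarrow> ('o, 'm, 'z) addcat_scheme \<Rightarrow> ('o, 'm) cpx \<Rightarrow> ('o, 'm) cpx \<Rightarrow> (nat \<Rightarrow> 'm) \<Rightarrow> bool" where
  "end_fixing_map n K X Y f \<longleftrightarrow>
     same_ends n X Y \<and> chain_map n K X Y f \<and>
     f 0 = Idm K (Tm X 0) \<and> f (n + 1) = Idm K (Tm X (n + 1))"

definition homotopic ::
  "nat \<Rightarrow> ('o, 'm, 'z) addcat_scheme \<Rightarrow> ('o, 'm) cpx \<Rightarrow> ('o, 'm) cpx
    \<Rightarrow> (nat \<Rightarrow> 'm) \<Rightarrow> (nat \<Rightarrow> 'm) \<Rightarrow> bool" where
  "homotopic n K X Y f g \<longleftrightarrow> (\<exists>\<phi>.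
     (\<forall>i\<in>{1..n + 1}. \<phi> i \<in> carrier (Hom K (Tm X i) (Tm Y (i - 1)))) \<and>
     \<phi> 1 \<cdot>\<^bsub>K\<^esub> Df X 0 = \<one>\<^bsub>Hom K (Tm X 0) (Tm Y 0)\<^esub> \<and>
     (\<forall>i\<in>{1..n}.
        g i \<otimes>\<^bsub>Hom K (Tm X i) (Tm Y i)\<^esub> inv\<^bsub>Hom K (Tm X i) (Tm Y i)\<^esub> f i =
        (Df Y (i - 1) \<cdot>\<^bsub>K\<^esub> \<phi> i) \<otimes>\<^bsub>Hom K (Tm X i) (Tm Y i)\<^esub> (\<phi> (i + 1) \<cdot>\<^bsub>K\<^esub> Df X i)) \<and>
     Df Y n \<cdot>\<^bsub>K\<^esub> \<phi> (n + 1) = \<one>\<^bsub>Hom K (Tm X (n + 1)) (Tm Y (n + 1))\<^esub>)"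

definition homotopy_equivalent ::
  "nat \<Rightarrow> ('o, 'm, 'z) addcat_scheme \<Rightarrow> ('o, 'm) cpx \<Rightarrow> ('o, 'm) cpx \<Rightarrow> bool" where
  "homotopy_equivalent n K X Y \<longleftrightarrow> (\<exists>f g.
     end_fixing_map n K X Y f \<and> end_fixing_map n K Y X g \<and>
     homotopic n K X X (\<lambda>i. g i \<cdot>\<^bsub>K\<^esub> f i) (\<lambda>i. Idm K (Tm X i)) \<and>
     homotopic n K Y Y (\<lambda>i. f i \<cdot>\<^bsub>K\<^esub> g i) (\<lambda>i. Idm K (Tm Y i)))"

definition homotopy_class ::
  "nat \<Rightarrow> ('o, 'm, 'z) addcat_scheme \<Rightarrow> ('o, 'm) cpx \<Rightarrow> ('o, 'm) cpx set" where
  "homotopy_class n K X = {Y. is_complex n K Y \<and> homotopy_equivalent n K X Y}"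


section \<open>Extensions and exangles\<close>

text \<open>
  \<open>Ext C A\<close> is the group \<open>\<E>(C, A)\<close>, contravariant in \<open>C\<close>; for \<open>c : C' \<rightarrow> C\<close> and \<open>a : A \<rightarrow> A'\<close> the map
  \<open>\<E>(c, a) : \<E>(C, A) \<rightarrow> \<E>(C', A')\<close> is \<open>EMap c a\<close>. The realization of an element \<open>\<delta>\<close> of \<open>\<E>(C, A)\<close>
  is \<open>Rlz C A \<delta>\<close>; the objects are arguments since the groups \<open>\<E>(C, A)\<close> need not be disjoint.
\<close>

record ('o, 'm, 'e) exdata = "('o, 'm) addcat" +
  Ext :: "'o \<Rightarrow> 'o \<Rightarrow> 'e monoid"
  EMap :: "'m \<Rightarrow> 'm \<Rightarrow> 'e \<Rightarrow> 'e"
  Rlz :: "'o \<Rightarrow> 'o \<Rightarrow> 'e \<Rightarrow> ('o, 'm) cpx set"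

text \<open>\<open>push K C a \<delta>\<close> is \<open>a\<^sub>*\<delta>\<close> and \<open>pull K A c \<delta>\<close> is \<open>c\<^sup>*\<delta>\<close>, for \<open>\<delta>\<close> in \<open>\<E>(C, A)\<close>.\<close>

definition push :: "('o, 'm, 'e, 'z) exdata_scheme \<Rightarrow> 'o \<Rightarrow> 'm \<Rightarrow> 'e \<Rightarrow> 'e" where
  "push K C a = EMap K (Idm K C) a"

definition pull :: "('o, 'm, 'e, 'z) exdata_scheme \<Rightarrow> 'o \<Rightarrow> 'm \<Rightarrow> 'e \<Rightarrow> 'e" where
  "pull K A c = EMap K c (Idm K A)"

locale biadditive_functor = additive_category K
  for K :: "('o, 'm, 'e, 'z) exdata_scheme" (structure) +
  assumes ext_comm_group: "\<lbrakk>C \<in> Obj K; A \<in> Obj K\<rbrakk> \<Longrightarrow> comm_group (Ext K C A)"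
    and emap_hom:
      "\<lbrakk>C \<in> Obj K; C' \<in> Obj K; A \<in> Obj K; A' \<in> Obj K;
        c \<in> carrier (Hom K C' C); a \<in> carrier (Hom K A A')\<rbrakk>
       \<Longrightarrow> EMap K c a \<in> hom (Ext K C A) (Ext K C' A')"
    and emap_id:
      "\<lbrakk>C \<in> Obj K; A \<in> Obj K; \<delta> \<in> carrier (Ext K C A)\<rbrakk> \<Longrightarrow> EMap K (Idm K C) (Idm K A) \<delta> = \<delta>"
    and emap_comp:
      "\<lbrakk>C \<in> Obj K; C' \<in> Obj K; C'' \<in> Obj K; A \<in> Obj K; A' \<in> Obj K; A'' \<in> Obj K;
        c \<in> carrier (Hom K C' C); c' \<in> carrier (Hom K C'' C');
        a \<in> carrier (Hom K A A'); a' \<in> carrier (Hom K A' A''); \<delta> \<in> carrier (Ext K C A)\<rbrakk>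
       \<Longrightarrow> EMap K (c \<cdot> c') (a' \<cdot> a) \<delta> = EMap K c' a' (EMap K c a \<delta>)"
    and emap_add_left:
      "\<lbrakk>C \<in> Obj K; C' \<in> Obj K; A \<in> Obj K; A' \<in> Obj K;
        c \<in> carrier (Hom K C' C); c' \<in> carrier (Hom K C' C); a \<in> carrier (Hom K A A');
        \<delta> \<in> carrier (Ext K C A)\<rbrakk>
       \<Longrightarrow> EMap K (c \<otimes>\<^bsub>Hom K C' C\<^esub> c') a \<delta> = EMap K c a \<delta> \<otimes>\<^bsub>Ext K C' A'\<^esub> EMap K c' a \<delta>"
    and emap_add_right:
      "\<lbrakk>C \<in> Obj K; C' \<in> Obj K; A \<in> Obj K; A' \<in> Obj K;
        c \<in> carrier (Hom K C' C); a \<in> carrier (Hom K A A'); a' \<in> carrier (Hom K A A');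
        \<delta> \<in> carrier (Ext K C A)\<rbrakk>
       \<Longrightarrow> EMap K c (a \<otimes>\<^bsub>Hom K A A'\<^esub> a') \<delta> = EMap K c a \<delta> \<otimes>\<^bsub>Ext K C' A'\<^esub> EMap K c a' \<delta>"

definition n_exangle ::
  "nat \<Rightarrow> ('o, 'm, 'e, 'z) exdata_scheme \<Rightarrow> ('o, 'm) cpx \<Rightarrow> 'e \<Rightarrow> bool" where
  "n_exangle n K X \<delta> \<longleftrightarrow>
     is_complex n K X \<and> \<delta> \<in> carrier (Ext K (Tm X (n + 1)) (Tm X 0)) \<and>
     (\<forall>W\<in>Obj K.
        (\<forall>i\<in>{1..n}.
           (\<lambda>f. Df X (i - 1) \<cdot>\<^bsub>K\<^esub> f) ` carrier (Hom K W (Tm X (i - 1))) =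
           kernel (Hom K W (Tm X i)) (Hom K W (Tm X (i + 1))) (\<lambda>f. Df X i \<cdot>\<^bsub>K\<^esub> f)) \<and>
        (\<lambda>f. Df X n \<cdot>\<^bsub>K\<^esub> f) ` carrier (Hom K W (Tm X n)) =
           kernel (Hom K W (Tm X (n + 1))) (Ext K W (Tm X 0)) (\<lambda>f. pull K (Tm X 0) f \<delta>)) \<and>
     (\<forall>W\<in>Obj K.
        (\<forall>i\<in>{1..n}.
           (\<lambda>g. g \<cdot>\<^bsub>K\<^esub> Df X i) ` carrier (Hom K (Tm X (i + 1)) W) =
           kernel (Hom K (Tm X i) W) (Hom K (Tm X (i - 1)) W) (\<lambda>g. g \<cdot>\<^bsub>K\<^esub> Df X (i - 1))) \<and>
        (\<lambda>g. g \<cdot>\<^bsub>K\<^esub> Df X 0) ` carrier (Hom K (Tm X 1) W) =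
           kernel (Hom K (Tm X 0) W) (Ext K (Tm X (n + 1)) W) (\<lambda>g. push K (Tm X (n + 1)) g \<delta>))"

text \<open>The realization of \<open>\<delta>\<close> is the class \<open>[X]\<close>.\<close>

definition distinguished ::
  "nat \<Rightarrow> ('o, 'm, 'e, 'z) exdata_scheme \<Rightarrow> ('o, 'm) cpx \<Rightarrow> 'e \<Rightarrow> bool" where
  "distinguished n K X \<delta> \<longleftrightarrow>
     is_complex n K X \<and> \<delta> \<in> carrier (Ext K (Tm X (n + 1)) (Tm X 0)) \<and>
     Rlz K (Tm X (n + 1)) (Tm X 0) \<delta> = homotopy_class n K X"

definition inflation :: "nat \<Rightarrow> ('o, 'm, 'e, 'z) exdata_scheme \<Rightarrow> 'o \<Rightarrow> 'o \<Rightarrow> 'm \<Rightarrow> bool" where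
  "inflation n K A B f \<longleftrightarrow>
     (\<exists>X \<delta>. distinguished n K X \<delta> \<and> Tm X 0 = A \<and> Tm X 1 = B \<and> Df X 0 = f)"

definition deflation :: "nat \<Rightarrow> ('o, 'm, 'e, 'z) exdata_scheme \<Rightarrow> 'o \<Rightarrow> 'o \<Rightarrow> 'm \<Rightarrow> bool" where
  "deflation n K A B f \<longleftrightarrow>
     (\<exists>X \<delta>. distinguished n K X \<delta> \<and> Tm X n = A \<and> Tm X (n + 1) = B \<and> Df X n = f)"

text \<open>\<open>A \<rightarrow> A \<rightarrow> Z \<rightarrow> \<dots> \<rightarrow> Z\<close> and \<open>Z \<rightarrow> \<dots> \<rightarrow> Z \<rightarrow> A \<rightarrow> A\<close> for a zero object \<open>Z\<close>\<close>

definition left_trivial_cpx :: "('o, 'm, 'z) addcat_scheme \<Rightarrow> 'o \<Rightarrow> 'o \<Rightarrow> ('o, 'm) cpx" where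
  "left_trivial_cpx K Z A =
     (let T = (\<lambda>i. if i \<le> 1 then A else Z)
      in \<lparr>Tm = T, Df = (\<lambda>i. if i = 0 then Idm K A else \<one>\<^bsub>Hom K (T i) (T (i + 1))\<^esub>)\<rparr>)"

definition right_trivial_cpx ::
  "nat \<Rightarrow> ('o, 'm, 'z) addcat_scheme \<Rightarrow> 'o \<Rightarrow> 'o \<Rightarrow> ('o, 'm) cpx" where
  "right_trivial_cpx n K Z A =
     (let T = (\<lambda>i. if i < n then Z else A)
      in \<lparr>Tm = T, Df = (\<lambda>i. if i = n then Idm K A else \<one>\<^bsub>Hom K (T i) (T (i + 1))\<^esub>)\<rparr>)"

text \<open>
  \<open>M\<close> is the mapping cone of \<open>f : X \<rightarrow> Y\<close> formed with some choice of biproducts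
  \<open>M\<^sub>i = X\<^sub>i\<^sub>+\<^sub>1 \<oplus> Y\<^sub>i\<close> (\<open>1 \<le> i \<le> n\<close>). A matrix of morphisms between biproducts is the sum of its
  entries, each preceded by a projection and followed by an injection.
\<close>

definition mapping_cone ::
  "nat \<Rightarrow> ('o, 'm, 'z) addcat_scheme \<Rightarrow> ('o, 'm) cpx \<Rightarrow> ('o, 'm) cpx \<Rightarrow> (nat \<Rightarrow> 'm)
    \<Rightarrow> ('o, 'm) cpx \<Rightarrow> bool" where
  "mapping_cone n K X Y f M \<longleftrightarrow> (\<exists>i1 i2 p1 p2.
     Tm M 0 = Tm X 1 \<and> Tm M (n + 1) = Tm Y (n + 1) \<and>
     (\<forall>i\<in>{1..n}. biproduct K (Tm X (i + 1)) (Tm Y i) (Tm M i) (i1 i) (i2 i) (p1 i) (p2 i)) \<and>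
     Df M 0 =
       (i1 1 \<cdot>\<^bsub>K\<^esub> (inv\<^bsub>Hom K (Tm X 1) (Tm X 2)\<^esub> Df X 1))
       \<otimes>\<^bsub>Hom K (Tm M 0) (Tm M 1)\<^esub> (i2 1 \<cdot>\<^bsub>K\<^esub> f 1) \<and>
     (\<forall>i\<in>{1..<n}. Df M i =
       (i1 (i + 1) \<cdot>\<^bsub>K\<^esub> (inv\<^bsub>Hom K (Tm X (i + 1)) (Tm X (i + 2))\<^esub> Df X (i + 1)) \<cdot>\<^bsub>K\<^esub> p1 i)
       \<otimes>\<^bsub>Hom K (Tm M i) (Tm M (i + 1))\<^esub> (i2 (i + 1) \<cdot>\<^bsub>K\<^esub> f (i + 1) \<cdot>\<^bsub>K\<^esub> p1 i)
       \<otimes>\<^bsub>Hom K (Tm M i) (Tm M (i + 1))\<^esub> (i2 (i + 1) \<cdot>\<^bsub>K\<^esub> Df Y i \<cdot>\<^bsub>K\<^esub> p2 i)) \<and>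
     Df M n =
       (f (n + 1) \<cdot>\<^bsub>K\<^esub> p1 n) \<otimes>\<^bsub>Hom K (Tm M n) (Tm M (n + 1))\<^esub> (Df Y n \<cdot>\<^bsub>K\<^esub> p2 n))"

text \<open>
  The dual notion, i.e. the mapping cone formed in the opposite category: the complex
  \<open>X\<^sub>0 \<rightarrow> Y\<^sub>0 \<oplus> X\<^sub>1 \<rightarrow> Y\<^sub>1 \<oplus> X\<^sub>2 \<rightarrow> \<dots> \<rightarrow> Y\<^sub>n\<^sub>-\<^sub>1 \<oplus> X\<^sub>n \<rightarrow> Y\<^sub>n\<close>. Dualizing moves the sign from the
  differentials of \<open>X\<close> to those of \<open>Y\<close>; this cannot be normalized away, as flipping all the signs
  of the differentials of both \<open>X\<close> and \<open>Y\<close> amounts to replacing the extension by \<open>(-1)\<^sup>n\<close> times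
  itself.
\<close>

definition mapping_cocone ::
  "nat \<Rightarrow> ('o, 'm, 'z) addcat_scheme \<Rightarrow> ('o, 'm) cpx \<Rightarrow> ('o, 'm) cpx \<Rightarrow> (nat \<Rightarrow> 'm)
    \<Rightarrow> ('o, 'm) cpx \<Rightarrow> bool" where
  "mapping_cocone n K X Y f N \<longleftrightarrow> (\<exists>i1 i2 p1 p2.
     Tm N 0 = Tm X 0 \<and> Tm N (n + 1) = Tm Y n \<and>
     (\<forall>i\<in>{1..n}. biproduct K (Tm Y (i - 1)) (Tm X i) (Tm N i) (i1 i) (i2 i) (p1 i) (p2 i)) \<and>
     Df N 0 =
       (i1 1 \<cdot>\<^bsub>K\<^esub> f 0) \<otimes>\<^bsub>Hom K (Tm N 0) (Tm N 1)\<^esub> (i2 1 \<cdot>\<^bsub>K\<^esub> Df X 0) \<and>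
     (\<forall>i\<in>{1..<n}. Df N i =
       (i1 (i + 1) \<cdot>\<^bsub>K\<^esub> (inv\<^bsub>Hom K (Tm Y (i - 1)) (Tm Y i)\<^esub> Df Y (i - 1)) \<cdot>\<^bsub>K\<^esub> p1 i)
       \<otimes>\<^bsub>Hom K (Tm N i) (Tm N (i + 1))\<^esub> (i1 (i + 1) \<cdot>\<^bsub>K\<^esub> f i \<cdot>\<^bsub>K\<^esub> p2 i)
       \<otimes>\<^bsub>Hom K (Tm N i) (Tm N (i + 1))\<^esub> (i2 (i + 1) \<cdot>\<^bsub>K\<^esub> Df X i \<cdot>\<^bsub>K\<^esub> p2 i)) \<and>
     Df N n =
       ((inv\<^bsub>Hom K (Tm Y (n - 1)) (Tm Y n)\<^esub> Df Y (n - 1)) \<cdot>\<^bsub>K\<^esub> p1 n)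
       \<otimes>\<^bsub>Hom K (Tm N n) (Tm N (n + 1))\<^esub> (f n \<cdot>\<^bsub>K\<^esub> p2 n))"

locale n_exangulated_category = biadditive_functor K
  for n :: nat and K :: "('o, 'm, 'e, 'z) exdata_scheme" (structure) +
  assumes n_pos: "n \<ge> 1"
    and realization:
      "\<lbrakk>C \<in> Obj K; A \<in> Obj K; \<delta> \<in> carrier (Ext K C A)\<rbrakk>
       \<Longrightarrow> \<exists>X. Tm X 0 = A \<and> Tm X (n + 1) = C \<and> distinguished n K X \<delta>"
    and R0:
      "\<lbrakk>distinguished n K X \<delta>; distinguished n K Y \<rho>;
        a \<in> carrier (Hom K (Tm X 0) (Tm Y 0)); c \<in> carrier (Hom K (Tm X (n + 1)) (Tm Y (n + 1)));
        push K (Tm X (n + 1)) a \<delta> = pull K (Tm Y 0) c \<rho>\<rbrakk>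
       \<Longrightarrow> \<exists>f. chain_map n K X Y f \<and> f 0 = a \<and> f (n + 1) = c"
    and R1: "distinguished n K X \<delta> \<Longrightarrow> n_exangle n K X \<delta>"
    and R2_left:
      "\<lbrakk>A \<in> Obj K; zero_object K Z\<rbrakk> \<Longrightarrow> distinguished n K (left_trivial_cpx K Z A) \<one>\<^bsub>Ext K Z A\<^esub>"
    and R2_right:
      "\<lbrakk>A \<in> Obj K; zero_object K Z\<rbrakk> \<Longrightarrow> distinguished n K (right_trivial_cpx n K Z A) \<one>\<^bsub>Ext K A Z\<^esub>"
    and EA1_inflation:
      "\<lbrakk>inflation n K A B f; inflation n K B D g\<rbrakk> \<Longrightarrow> inflation n K A D (g \<cdot> f)"
    and EA1_deflation:
      "\<lbrakk>deflation n K A B f; deflation n K B D g\<rbrakk> \<Longrightarrow> deflation n K A D (g \<cdot> f)"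
    and EA2:
      "\<lbrakk>A \<in> Obj K; C \<in> Obj K; D \<in> Obj K; \<rho> \<in> carrier (Ext K D A); c \<in> carrier (Hom K C D);
        distinguished n K X (pull K A c \<rho>); Tm X 0 = A; Tm X (n + 1) = C;
        distinguished n K Y \<rho>; Tm Y 0 = A; Tm Y (n + 1) = D\<rbrakk>
       \<Longrightarrow> \<exists>f M. chain_map n K X Y f \<and> f 0 = Idm K A \<and> f (n + 1) = c \<and>
             mapping_cone n K X Y f M \<and> distinguished n K M (push K D (Df X 0) \<rho>)"
    and EA2_op:
      "\<lbrakk>A \<in> Obj K; B \<in> Obj K; C \<in> Obj K; \<delta> \<in> carrier (Ext K C A); a \<in> carrier (Hom K A B);
        distinguished n K X \<delta>; Tm X 0 = A; Tm X (n + 1) = C;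
        distinguished n K Y (push K C a \<delta>); Tm Y 0 = B; Tm Y (n + 1) = C\<rbrakk>
       \<Longrightarrow> \<exists>f N. chain_map n K X Y f \<and> f 0 = a \<and> f (n + 1) = Idm K C \<and>
             mapping_cocone n K X Y f N \<and> distinguished n K N (pull K A (Df Y n) \<delta>)"


section \<open>Ideals, phantom morphisms, projective and injective morphisms\<close>

text \<open>
  An ideal is given as a set \<open>I\<close> of morphisms; since hom-sets are disjoint, this is the same as the
  family of the \<open>I(A, B) = I \<inter> Hom(A, B)\<close>.
\<close>

definition is_ideal :: "('o, 'm, 'z) addcat_scheme \<Rightarrow> 'm set \<Rightarrow> bool" where
  "is_ideal K I \<longleftrightarrow>
     I \<subseteq> (\<Union>A\<in>Obj K. \<Union>B\<in>Obj K. carrier (Hom K A B)) \<and>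
     (\<forall>A\<in>Obj K. \<forall>B\<in>Obj K. subgroup (I \<inter> carrier (Hom K A B)) (Hom K A B)) \<and>
     (\<forall>A\<in>Obj K. \<forall>B\<in>Obj K. \<forall>D\<in>Obj K. \<forall>f\<in>carrier (Hom K A B). \<forall>g\<in>carrier (Hom K B D).
        f \<in> I \<or> g \<in> I \<longrightarrow> g \<cdot>\<^bsub>K\<^esub> f \<in> I)"

definition right_perp :: "('o, 'm, 'e, 'z) exdata_scheme \<Rightarrow> 'm set \<Rightarrow> 'm set" where
  "right_perp K I = {g. \<exists>A\<in>Obj K. \<exists>B\<in>Obj K. g \<in> carrier (Hom K A B) \<and>
     (\<forall>X\<in>Obj K. \<forall>C\<in>Obj K. \<forall>m\<in>I \<inter> carrier (Hom K X C). \<forall>\<delta>\<in>carrier (Ext K C A).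
        EMap K m g \<delta> = \<one>\<^bsub>Ext K X B\<^esub>)}"

definition special_precover ::
  "nat \<Rightarrow> ('o, 'm, 'e, 'z) exdata_scheme \<Rightarrow> 'm set \<Rightarrow> 'o \<Rightarrow> 'm \<Rightarrow> bool" where
  "special_precover n K I C i \<longleftrightarrow> i \<in> I \<and>
     (\<exists>A\<in>Obj K. \<exists>A'\<in>Obj K. \<exists>\<delta>\<in>carrier (Ext K C A). \<exists>j\<in>right_perp K I \<inter> carrier (Hom K A A').
      \<exists>Y. Tm Y 0 = A' \<and> Tm Y (n + 1) = C \<and> distinguished n K Y (push K C j \<delta>) \<and> Df Y n = i)"

definition special_precovering ::
  "nat \<Rightarrow> ('o, 'm, 'e, 'z) exdata_scheme \<Rightarrow> 'm set \<Rightarrow> bool" where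
  "special_precovering n K I \<longleftrightarrow> (\<forall>C\<in>Obj K. \<exists>i. special_precover n K I C i)"

definition additive_subfunctor ::
  "('o, 'm, 'e, 'z) exdata_scheme \<Rightarrow> ('o \<Rightarrow> 'o \<Rightarrow> 'e set) \<Rightarrow> bool" where
  "additive_subfunctor K F \<longleftrightarrow>
     (\<forall>C\<in>Obj K. \<forall>A\<in>Obj K. subgroup (F C A) (Ext K C A)) \<and>
     (\<forall>C\<in>Obj K. \<forall>A\<in>Obj K. \<forall>A'\<in>Obj K. \<forall>a\<in>carrier (Hom K A A'). \<forall>\<delta>\<in>F C A.
        push K C a \<delta> \<in> F C A') \<and>
     (\<forall>C\<in>Obj K. \<forall>C'\<in>Obj K. \<forall>A\<in>Obj K. \<forall>c\<in>carrier (Hom K C' C). \<forall>\<delta>\<in>F C A.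
        pull K A c \<delta> \<in> F C' A)"

definition Ph :: "('o, 'm, 'e, 'z) exdata_scheme \<Rightarrow> ('o \<Rightarrow> 'o \<Rightarrow> 'e set) \<Rightarrow> 'm set" where
  "Ph K F = {\<phi>. \<exists>X\<in>Obj K. \<exists>C\<in>Obj K. \<phi> \<in> carrier (Hom K X C) \<and>
     (\<forall>A\<in>Obj K. \<forall>\<delta>\<in>carrier (Ext K C A). pull K A \<phi> \<delta> \<in> F X A)}"

definition inj_morphisms ::
  "('o, 'm, 'e, 'z) exdata_scheme \<Rightarrow> ('o \<Rightarrow> 'o \<Rightarrow> 'e set) \<Rightarrow> 'm set" where
  "inj_morphisms K F = {g. \<exists>A\<in>Obj K. \<exists>B\<in>Obj K. g \<in> carrier (Hom K A B) \<and>
     (\<forall>C\<in>Obj K. \<forall>\<delta>\<in>F C A. push K C g \<delta> = \<one>\<^bsub>Ext K C B\<^esub>)}"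

definition enough_injective_morphisms ::
  "nat \<Rightarrow> ('o, 'm, 'e, 'z) exdata_scheme \<Rightarrow> ('o \<Rightarrow> 'o \<Rightarrow> 'e set) \<Rightarrow> bool" where
  "enough_injective_morphisms n K F \<longleftrightarrow> (\<forall>A\<in>Obj K. \<exists>X \<delta>.
     distinguished n K X \<delta> \<and> Tm X 0 = A \<and> \<delta> \<in> F (Tm X (n + 1)) A \<and> Df X 0 \<in> inj_morphisms K F)"

definition projective_morphism ::
  "('o, 'm, 'e, 'z) exdata_scheme \<Rightarrow> 'o \<Rightarrow> 'o \<Rightarrow> 'm \<Rightarrow> bool" where
  "projective_morphism K P A p \<longleftrightarrow> p \<in> carrier (Hom K P A) \<and>
     (\<forall>B\<in>Obj K. \<forall>\<eta>\<in>carrier (Ext K A B). pull K B p \<eta> = \<one>\<^bsub>Ext K P B\<^esub>)"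

definition enough_projective_morphisms ::
  "nat \<Rightarrow> ('o, 'm, 'e, 'z) exdata_scheme \<Rightarrow> bool" where
  "enough_projective_morphisms n K \<longleftrightarrow> (\<forall>A\<in>Obj K. \<exists>X \<delta>.
     distinguished n K X \<delta> \<and> Tm X (n + 1) = A \<and> projective_morphism K (Tm X n) A (Df X n))"

end

theory Submission
  imports Defs
begin

text \<open>
  Given \<open>C\<close>, take an exangle \<open>\<delta> \<in> \<E>(C, A)\<close> whose deflation \<open>p\<close> is projective and an inflation
  \<open>e : A \<rightarrow> E\<close> of an exangle \<open>\<gamma> \<in> \<F>(D, A)\<close> with \<open>e\<close> an \<open>\<F>\<close>-injective morphism. The deflation \<open>i\<close> of
  \<open>e\<^sub>*\<delta>\<close> is the required precover. As \<open>e\<close> kills \<open>\<F>\<close>, it lies in \<open>Ph(\<F>)\<^sup>\<bottom>\<close>. To see that \<open>i\<close> is a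
  phantom, note that every \<open>\<eta> \<in> \<E>(C, B)\<close> satisfies \<open>p\<^sup>*\<eta> = 0\<close>, hence \<open>\<eta> = g\<^sub>*\<delta>\<close> for some \<open>g\<close>, and that
  \<open>e\<^sub>*i\<^sup>*\<delta> = i\<^sup>*e\<^sub>*\<delta> = 0\<close>, hence \<open>i\<^sup>*\<delta> = c\<^sup>*\<gamma> \<in> \<F>\<close> for some \<open>c\<close>; so \<open>i\<^sup>*\<eta> = g\<^sub>*i\<^sup>*\<delta> \<in> \<F>\<close>. Both factorizations
  express that the two long exact sequences of an exangle extend by one more term.
\<close>

section \<open>Pushforward and pullback of extensions\<close>

context biadditive_functor
begin

lemma emap_closed:
  assumes "C \<in> Obj K" "C' \<in> Obj K" "A \<in> Obj K" "A' \<in> Obj K"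
    and "c \<in> carrier (Hom K C' C)" "a \<in> carrier (Hom K A A')" "\<delta> \<in> carrier (Ext K C A)"
  shows "EMap K c a \<delta> \<in> carrier (Ext K C' A')"
  using emap_hom[OF assms(1-6)] assms(7) by (auto simp: hom_def)

lemma pull_closed:
  assumes "C \<in> Obj K" "C' \<in> Obj K" "A \<in> Obj K"
    and "c \<in> carrier (Hom K C' C)" "\<delta> \<in> carrier (Ext K C A)"
  shows "pull K A c \<delta> \<in> carrier (Ext K C' A)"
  unfolding pull_def using assms by (intro emap_closed[of C _ A] id_closed)

lemma push_closed:
  assumes "C \<in> Obj K" "A \<in> Obj K" "A' \<in> Obj K"
    and "a \<in> carrier (Hom K A A')" "\<delta> \<in> carrier (Ext K C A)"
  shows "push K C a \<delta> \<in> carrier (Ext K C A')"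
  unfolding push_def using assms by (intro emap_closed[of C _ A] id_closed)

lemma pull_id:
  assumes "C \<in> Obj K" "A \<in> Obj K" "\<delta> \<in> carrier (Ext K C A)"
  shows "pull K A (Idm K C) \<delta> = \<delta>"
  unfolding pull_def using assms by (rule emap_id)

lemma push_id:
  assumes "C \<in> Obj K" "A \<in> Obj K" "\<delta> \<in> carrier (Ext K C A)"
  shows "push K C (Idm K A) \<delta> = \<delta>"
  unfolding push_def using assms by (rule emap_id)

lemma pull_comp:
  assumes "C \<in> Obj K" "C' \<in> Obj K" "C'' \<in> Obj K" "A \<in> Obj K"
    and "c \<in> carrier (Hom K C' C)" "c' \<in> carrier (Hom K C'' C')" "\<delta> \<in> carrier (Ext K C A)"
  shows "pull K A (c \<cdot> c') \<delta> = pull K A c' (pull K A c \<delta>)"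
  using emap_comp[OF assms(1-4,4,4-6) id_closed[OF assms(4)] id_closed[OF assms(4)] assms(7)]
    id_left[OF assms(4,4) id_closed[OF assms(4)]]
  by (simp add: pull_def)

lemma push_comp:
  assumes "C \<in> Obj K" "A \<in> Obj K" "A' \<in> Obj K" "A'' \<in> Obj K"
    and "a \<in> carrier (Hom K A A')" "a' \<in> carrier (Hom K A' A'')" "\<delta> \<in> carrier (Ext K C A)"
  shows "push K C (a' \<cdot> a) \<delta> = push K C a' (push K C a \<delta>)"
  using emap_comp[OF assms(1,1,1-4) id_closed[OF assms(1)] id_closed[OF assms(1)] assms(5-7)]
    id_left[OF assms(1,1) id_closed[OF assms(1)]]
  by (simp add: push_def)

text \<open>Together with \<open>pull_push\<close> this says that pushing along \<open>a\<close> and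
  pulling along \<open>c\<close> commute. Both composites are reduced to the common form
  \<open>EMap K c a\<close>, so either order can be rewritten into the other.\<close>

lemma push_pull:
  assumes "C \<in> Obj K" "C' \<in> Obj K" "A \<in> Obj K" "A' \<in> Obj K"
    and "c \<in> carrier (Hom K C' C)" "a \<in> carrier (Hom K A A')" "\<delta> \<in> carrier (Ext K C A)"
  shows "push K C' a (pull K A c \<delta>) = EMap K c a \<delta>"
  using emap_comp[OF assms(1,2,2,3,3,4,5) id_closed[OF assms(2)] id_closed[OF assms(3)] assms(6,7)]
    id_right[OF assms(2,1,5)] id_right[OF assms(3,4,6)]
  by (simp add: pull_def push_def)

lemma pull_push:
  assumes "C \<in> Obj K" "C' \<in> Obj K" "A \<in> Obj K" "A' \<in> Obj K"
    and "c \<in> carrier (Hom K C' C)" "a \<in> carrier (Hom K A A')" "\<delta> \<in> carrier (Ext K C A)"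
  shows "pull K A' c (push K C a \<delta>) = EMap K c a \<delta>"
  using emap_comp[OF assms(1,1,2,3,4,4) id_closed[OF assms(1)] assms(5,6) id_closed[OF assms(4)] assms(7)]
    id_left[OF assms(2,1,5)] id_left[OF assms(3,4,6)]
  by (simp add: pull_def push_def)

lemma pull_mult:
  assumes "C \<in> Obj K" "C' \<in> Obj K" "A \<in> Obj K" "c \<in> carrier (Hom K C' C)"
    and "\<delta> \<in> carrier (Ext K C A)" "\<delta>' \<in> carrier (Ext K C A)"
  shows "pull K A c (\<delta> \<otimes>\<^bsub>Ext K C A\<^esub> \<delta>') = pull K A c \<delta> \<otimes>\<^bsub>Ext K C' A\<^esub> pull K A c \<delta>'"
  using emap_hom[OF assms(1,2,3,3,4) id_closed[OF assms(3)]] assms(5,6)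
  by (auto simp: hom_def pull_def)

lemma push_mult:
  assumes "C \<in> Obj K" "A \<in> Obj K" "A' \<in> Obj K" "a \<in> carrier (Hom K A A')"
    and "\<delta> \<in> carrier (Ext K C A)" "\<delta>' \<in> carrier (Ext K C A)"
  shows "push K C a (\<delta> \<otimes>\<^bsub>Ext K C A\<^esub> \<delta>') = push K C a \<delta> \<otimes>\<^bsub>Ext K C A'\<^esub> push K C a \<delta>'"
  using emap_hom[OF assms(1,1,2,3) id_closed[OF assms(1)] assms(4)] assms(5,6)
  by (auto simp: hom_def push_def)

lemma pull_one:
  assumes "C \<in> Obj K" "C' \<in> Obj K" "A \<in> Obj K" "c \<in> carrier (Hom K C' C)"
  shows "pull K A c \<one>\<^bsub>Ext K C A\<^esub> = \<one>\<^bsub>Ext K C' A\<^esub>"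
  unfolding pull_def
  using emap_hom[OF assms(1,2,3,3,4) id_closed[OF assms(3)]] ext_comm_group assms
  by (intro hom_one) (auto simp: comm_group_def)

lemma push_one:
  assumes "C \<in> Obj K" "A \<in> Obj K" "A' \<in> Obj K" "a \<in> carrier (Hom K A A')"
  shows "push K C a \<one>\<^bsub>Ext K C A\<^esub> = \<one>\<^bsub>Ext K C A'\<^esub>"
  unfolding push_def
  using emap_hom[OF assms(1,1,2,3) id_closed[OF assms(1)] assms(4)] ext_comm_group assms
  by (intro hom_one) (auto simp: comm_group_def)

text \<open>Biadditivity makes the pullback of \<delta> along 0 idempotent, since 0 + 0 = 0, and the
  only idempotent of a group is its neutral element. The dual statement follows in the same
  way.\<close>

lemma pull_zero:
  assumes "C \<in> Obj K" "C' \<in> Obj K" "A \<in> Obj K" "\<delta> \<in> carrier (Ext K C A)"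
  shows "pull K A \<one>\<^bsub>Hom K C' C\<^esub> \<delta> = \<one>\<^bsub>Ext K C' A\<^esub>"
proof -
  interpret H: comm_group "Hom K C' C" using assms hom_comm_group by blast
  interpret E: comm_group "Ext K C' A" using assms ext_comm_group by blast
  have "pull K A \<one>\<^bsub>Hom K C' C\<^esub> \<delta> \<otimes>\<^bsub>Ext K C' A\<^esub> pull K A \<one>\<^bsub>Hom K C' C\<^esub> \<delta> = pull K A \<one>\<^bsub>Hom K C' C\<^esub> \<delta>"
    using emap_add_left[OF assms(1,2,3,3) H.one_closed H.one_closed id_closed[OF assms(3)] assms(4)]
    by (simp add: pull_def)
  then show ?thesis
    using pull_closed[OF assms(1-3) H.one_closed assms(4)] by simp
qed

lemma push_zero:
  assumes "C \<in> Obj K" "A \<in> Obj K" "A' \<in> Obj K" "\<delta> \<in> carrier (Ext K C A)"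
  shows "push K C \<one>\<^bsub>Hom K A A'\<^esub> \<delta> = \<one>\<^bsub>Ext K C A'\<^esub>"
proof -
  interpret H: comm_group "Hom K A A'" using assms hom_comm_group by blast
  interpret E: comm_group "Ext K C A'" using assms ext_comm_group by blast
  have "push K C \<one>\<^bsub>Hom K A A'\<^esub> \<delta> \<otimes>\<^bsub>Ext K C A'\<^esub> push K C \<one>\<^bsub>Hom K A A'\<^esub> \<delta> = push K C \<one>\<^bsub>Hom K A A'\<^esub> \<delta>"
    using emap_add_right[OF assms(1,1,2,3) id_closed[OF assms(1)] H.one_closed H.one_closed assms(4)]
    by (simp add: push_def)
  then show ?thesis
    using push_closed[OF assms(1-3) H.one_closed assms(4)] by simp
qed

end

section \<open>Exactness at the ends of a distinguished exangle\<close>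

context n_exangulated_category
begin

lemma distinguishedD:
  assumes "distinguished n K X \<delta>"
  shows "\<And>i. i \<le> n + 1 \<Longrightarrow> Tm X i \<in> Obj K"
    and "\<And>i. i \<le> n \<Longrightarrow> Df X i \<in> carrier (Hom K (Tm X i) (Tm X (i + 1)))"
    and "\<delta> \<in> carrier (Ext K (Tm X (n + 1)) (Tm X 0))"
  using assms by (auto simp: distinguished_def is_complex_def)

text \<open>This is the inclusion of the kernel in the image, at the last Hom group of the covariant
  exact sequence supplied by \<open>R1\<close>.\<close>

lemma factor_through_deflation:
  assumes X: "distinguished n K X \<delta>" and W: "W \<in> Obj K"
    and f: "f \<in> carrier (Hom K W (Tm X (n + 1)))"
    and "pull K (Tm X 0) f \<delta> = \<one>\<^bsub>Ext K W (Tm X 0)\<^esub>"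
  shows "\<exists>g\<in>carrier (Hom K W (Tm X n)). f = Df X n \<cdot> g"
proof -
  have "f \<in> kernel (Hom K W (Tm X (n + 1))) (Ext K W (Tm X 0)) (\<lambda>f. pull K (Tm X 0) f \<delta>)"
    using assms by (simp add: kernel_def)
  also have "\<dots> = (\<lambda>f. Df X n \<cdot> f) ` carrier (Hom K W (Tm X n))"
    using R1[OF X] W by (auto simp: n_exangle_def)
  finally show ?thesis by blast
qed

lemma factor_through_inflation:
  assumes X: "distinguished n K X \<delta>" and W: "W \<in> Obj K"
    and f: "f \<in> carrier (Hom K (Tm X 0) W)"
    and "push K (Tm X (n + 1)) f \<delta> = \<one>\<^bsub>Ext K (Tm X (n + 1)) W\<^esub>"
  shows "\<exists>g\<in>carrier (Hom K (Tm X 1) W). f = g \<cdot> Df X 0"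
proof -
  have "f \<in> kernel (Hom K (Tm X 0) W) (Ext K (Tm X (n + 1)) W) (\<lambda>g. push K (Tm X (n + 1)) g \<delta>)"
    using assms by (simp add: kernel_def)
  also have "\<dots> = (\<lambda>g. g \<cdot> Df X 0) ` carrier (Hom K (Tm X 1) W)"
    using R1[OF X] W by (auto simp: n_exangle_def)
  finally show ?thesis by blast
qed

text \<open>The opposite inclusion, of the image in the kernel, evaluated at the identity of
  \<open>Tm X n\<close>.\<close>

lemma pull_deflation:
  assumes X: "distinguished n K X \<delta>"
  shows "pull K (Tm X 0) (Df X n) \<delta> = \<one>\<^bsub>Ext K (Tm X n) (Tm X 0)\<^esub>"
proof -
  note T = distinguishedD[OF X]
  have "Df X n \<cdot> Idm K (Tm X n) \<in> (\<lambda>f. Df X n \<cdot> f) ` carrier (Hom K (Tm X n) (Tm X n))"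
    using T(1)[of n] by (intro imageI id_closed) auto
  also have "\<dots> = kernel (Hom K (Tm X n) (Tm X (n + 1))) (Ext K (Tm X n) (Tm X 0))
      (\<lambda>f. pull K (Tm X 0) f \<delta>)"
    using R1[OF X] T(1)[of n] by (auto simp: n_exangle_def)
  finally show ?thesis
    using id_right[OF T(1)[of n] T(1)[of "n + 1"] T(2)[of n]] by (simp add: kernel_def)
qed

lemma push_inflation:
  assumes X: "distinguished n K X \<delta>"
  shows "push K (Tm X (n + 1)) (Df X 0) \<delta> = \<one>\<^bsub>Ext K (Tm X (n + 1)) (Tm X 1)\<^esub>"
proof -
  note T = distinguishedD[OF X]
  have "Idm K (Tm X 1) \<cdot> Df X 0 \<in> (\<lambda>g. g \<cdot> Df X 0) ` carrier (Hom K (Tm X 1) (Tm X 1))"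
    using T(1)[of 1] by (intro imageI id_closed) auto
  also have "\<dots> = kernel (Hom K (Tm X 0) (Tm X 1)) (Ext K (Tm X (n + 1)) (Tm X 1))
      (\<lambda>g. push K (Tm X (n + 1)) g \<delta>)"
    using R1[OF X] T(1)[of 1] by (auto simp: n_exangle_def)
  finally show ?thesis
    using id_left[of "Tm X 0" "Tm X 1" "Df X 0"] T(1)[of 0] T(1)[of 1] T(2)[of 0] by (simp add: kernel_def)
qed

section \<open>One more term in the long exact sequences\<close>

text \<open>
  Combine \<open>\<delta>\<close> and \<open>\<theta>\<close> to \<open>\<rho> \<in> \<E>(C \<oplus> D, A)\<close>, realized by \<open>V\<close>. The cone of \<open>X \<rightarrow> V\<close> over \<open>C \<rightarrow> C \<oplus> D\<close>
  realizes \<open>(d\<^sub>X\<^sup>0)\<^sub>*\<rho> = 0\<close>, so its deflation \<open>C \<oplus> V\<^sub>n \<rightarrow> C \<oplus> D\<close> is split; the component \<open>D \<rightarrow> C\<close> of a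
  section is the required morphism, because \<open>d\<^sub>V\<^sup>n\<close> kills \<open>\<rho>\<close>.
\<close>
lemma push_inflation_eq_one_imp_pull:
  assumes X: "distinguished n K X \<delta>" and D: "D \<in> Obj K"
    and \<theta>: "\<theta> \<in> carrier (Ext K D (Tm X 0))"
    and kill: "push K D (Df X 0) \<theta> = \<one>\<^bsub>Ext K D (Tm X 1)\<^esub>"
  shows "\<exists>u\<in>carrier (Hom K D (Tm X (n + 1))). \<theta> = pull K (Tm X 0) u \<delta>"
proof -
  define A C where "A = Tm X 0" and "C = Tm X (n + 1)"
  have A: "A \<in> Obj K" and C: "C \<in> Obj K" and X1: "Tm X 1 \<in> Obj K"
    using distinguishedD(1)[OF X] by (auto simp: A_def C_def)
  have dX: "Df X 0 \<in> carrier (Hom K A (Tm X 1))"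
    using distinguishedD(2)[OF X, of 0] by (simp add: A_def)
  have \<delta>: "\<delta> \<in> carrier (Ext K C A)" using distinguishedD(3)[OF X] by (simp add: A_def C_def)
  have \<theta>: "\<theta> \<in> carrier (Ext K D A)" using \<theta> by (simp add: A_def)
  obtain S i1 i2 p1 p2 where bi: "biproduct K C D S i1 i2 p1 p2"
    using biproduct_exists[OF C D] by blast
  have S: "S \<in> Obj K" and i1: "i1 \<in> carrier (Hom K C S)" and i2: "i2 \<in> carrier (Hom K D S)"
    and p1: "p1 \<in> carrier (Hom K S C)" and p2: "p2 \<in> carrier (Hom K S D)"
    and pi: "p1 \<cdot> i1 = Idm K C" "p2 \<cdot> i2 = Idm K D"
      "p1 \<cdot> i2 = \<one>\<^bsub>Hom K D C\<^esub>" "p2 \<cdot> i1 = \<one>\<^bsub>Hom K C D\<^esub>"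
    using bi by (auto simp: biproduct_def)
  interpret EC: comm_group "Ext K C A" using ext_comm_group C A .
  interpret ED: comm_group "Ext K D A" using ext_comm_group D A .
  interpret ES: comm_group "Ext K S A" using ext_comm_group S A .
  interpret ES1: comm_group "Ext K S (Tm X 1)" using ext_comm_group S X1 .
  \<comment> \<open>The element that corresponds to (\<delta>, \<theta>) when E(C \<oplus> D, A) is
    identified with E(C, A) \<oplus> E(D, A); pulling back along \<open>i1\<close> and
    \<open>i2\<close> recovers the two components.\<close>
  define \<rho> where "\<rho> = pull K A p1 \<delta> \<otimes>\<^bsub>Ext K S A\<^esub> pull K A p2 \<theta>"
  note c1 = pull_closed[OF C S A p1 \<delta>] and c2 = pull_closed[OF D S A p2 \<theta>]
  have \<rho>: "\<rho> \<in> carrier (Ext K S A)" using c1 c2 by (simp add: \<rho>_def)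
  have \<rho>1: "pull K A i1 \<rho> = \<delta>"
    unfolding \<rho>_def pull_mult[OF S C A i1 c1 c2]
      pull_comp[OF C S C A p1 i1 \<delta>, symmetric] pull_comp[OF D S C A p2 i1 \<theta>, symmetric] pi
      pull_id[OF C A \<delta>] pull_zero[OF D C A \<theta>] using \<delta> by simp
  have \<rho>2: "pull K A i2 \<rho> = \<theta>"
    unfolding \<rho>_def pull_mult[OF S D A i2 c1 c2]
      pull_comp[OF C S D A p1 i2 \<delta>, symmetric] pull_comp[OF D S D A p2 i2 \<theta>, symmetric] pi
      pull_id[OF D A \<theta>] pull_zero[OF C D A \<delta>] using \<theta> by simp
  have "push K C (Df X 0) \<delta> = \<one>\<^bsub>Ext K C (Tm X 1)\<^esub>"
    using push_inflation[OF X] by (simp add: C_def)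
  \<comment> \<open>Pushing along \<open>Df X 0\<close> commutes with both pullbacks; it kills
    \<delta> by exactness and \<theta> by hypothesis.\<close>
  then have \<rho>0: "push K S (Df X 0) \<rho> = \<one>\<^bsub>Ext K S (Tm X 1)\<^esub>"
    unfolding \<rho>_def push_mult[OF S A X1 dX c1 c2]
      push_pull[OF C S A X1 p1 dX \<delta>] push_pull[OF D S A X1 p2 dX \<theta>]
      pull_push[OF C S A X1 p1 dX \<delta>, symmetric] pull_push[OF D S A X1 p2 dX \<theta>, symmetric]
    using kill pull_one[OF C S X1 p1] pull_one[OF D S X1 p2] by (simp del: One_nat_def)
  obtain V where V: "Tm V 0 = A" "Tm V (n + 1) = S" "distinguished n K V \<rho>"
    using realization[OF S A \<rho>] by blast
  have Vn: "Tm V n \<in> Obj K" using distinguishedD(1)[OF V(3), of n] by simp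
  have dV: "Df V n \<in> carrier (Hom K (Tm V n) S)" using distinguishedD(2)[OF V(3), of n] V by simp
  \<comment> \<open>The pullback of \<rho> along \<open>i1\<close> is \<delta>, so the given
    \<open>X\<close> itself can serve as the source of the lift in \<open>EA2\<close>.\<close>
  obtain f M where f: "f (n + 1) = i1" and cone: "mapping_cone n K X V f M"
    and M: "distinguished n K M (push K S (Df X 0) \<rho>)"
    using EA2[OF A C S \<rho> i1 _ A_def[symmetric] C_def[symmetric] V(3,1,2)] X \<rho>1 by metis
  \<comment> \<open>At index \<open>n\<close>, which lies in the range of the biproducts as
    \<open>n \<ge> 1\<close>, the cone has the term X_{n+1} \<oplus> V_n = C \<oplus> V_n.\<close>
  obtain j1 j2 q1 q2 where "biproduct K C (Tm V n) (Tm M n) (j1 n) (j2 n) (q1 n) (q2 n)"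
    and M0: "Tm M 0 = Tm X 1" and Me: "Tm M (n + 1) = S"
    and dM: "Df M n = (i1 \<cdot> q1 n) \<otimes>\<^bsub>Hom K (Tm M n) S\<^esub> (Df V n \<cdot> q2 n)"
    using cone n_pos f V(2) unfolding mapping_cone_def C_def
    by (metis atLeastAtMost_iff order_refl)
  then have Mn: "Tm M n \<in> Obj K" and q1: "q1 n \<in> carrier (Hom K (Tm M n) C)"
    and q2: "q2 n \<in> carrier (Hom K (Tm M n) (Tm V n))"
    by (auto simp: biproduct_def)
  \<comment> \<open>The extension of \<open>M\<close> is 0, so every morphism into \<open>S\<close>
    lifts through its deflation. Only the restriction of a section to \<open>D\<close> is used,
    namely a lift of \<open>i2\<close>.\<close>
  obtain g where g: "g \<in> carrier (Hom K D (Tm M n))" and i2g: "i2 = Df M n \<cdot> g"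
    using factor_through_deflation[OF M D] i2 \<rho>0 pull_one[OF S D X1 i2] M0 Me by auto
  define u v where "u = q1 n \<cdot> g" and "v = q2 n \<cdot> g"
  have u: "u \<in> carrier (Hom K D C)" unfolding u_def using comp_closed[OF D Mn C g q1] .
  have v: "v \<in> carrier (Hom K D (Tm V n))" unfolding v_def using comp_closed[OF D Mn Vn g q2] .
  have i2_eq: "i2 = (i1 \<cdot> u) \<otimes>\<^bsub>Hom K D S\<^esub> (Df V n \<cdot> v)"
    unfolding i2g dM u_def v_def
      comp_add_left[OF D Mn S g comp_closed[OF Mn C S q1 i1] comp_closed[OF Mn Vn S q2 dV]]
      comp_assoc[OF D Mn C S g q1 i1] comp_assoc[OF D Mn Vn S g q2 dV] ..
  have "\<theta> = pull K A (i1 \<cdot> u) \<rho> \<otimes>\<^bsub>Ext K D A\<^esub> pull K A (Df V n \<cdot> v) \<rho>"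
    using emap_add_left[OF S D A A comp_closed[OF D C S u i1] comp_closed[OF D Vn S v dV]
        id_closed[OF A] \<rho>] \<rho>2 i2_eq by (simp add: pull_def)
  also have "pull K A (i1 \<cdot> u) \<rho> = pull K A u \<delta>"
    using pull_comp[OF S C D A i1 u \<rho>] \<rho>1 by simp
  also have "pull K A (Df V n \<cdot> v) \<rho> = \<one>\<^bsub>Ext K D A\<^esub>"
    using pull_comp[OF S Vn D A dV v \<rho>] pull_deflation[OF V(3)] V(1) pull_one[OF Vn D A v] by simp
  finally have "\<theta> = pull K A u \<delta>" using pull_closed[OF C D A u \<delta>] by simp
  with u show ?thesis by (auto simp: A_def C_def)
qed

text \<open>The dual argument. Combine \<delta> and \<eta> to \<rho> in E(C, A \<oplus> B), realized
  by \<open>V\<close>. The cocone of V \<rightarrow> X over the projection to \<open>A\<close>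
  realizes the pullback of \<rho> along \<open>Df X n\<close>, which is 0, so its inflation A
  \<oplus> B \<rightarrow> A \<oplus> V_1 splits. The component A \<rightarrow> B of a retraction is
  the required morphism, because \<open>Df V 0\<close> kills \<rho>.\<close>

lemma pull_deflation_eq_one_imp_push:
  assumes X: "distinguished n K X \<delta>" and B: "B \<in> Obj K"
    and \<eta>: "\<eta> \<in> carrier (Ext K (Tm X (n + 1)) B)"
    and kill: "pull K B (Df X n) \<eta> = \<one>\<^bsub>Ext K (Tm X n) B\<^esub>"
  shows "\<exists>u\<in>carrier (Hom K (Tm X 0) B). \<eta> = push K (Tm X (n + 1)) u \<delta>"
proof -
  define A C where "A = Tm X 0" and "C = Tm X (n + 1)"
  have A: "A \<in> Obj K" and C: "C \<in> Obj K" and Xn: "Tm X n \<in> Obj K"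
    using distinguishedD(1)[OF X] by (auto simp: A_def C_def)
  have dX: "Df X n \<in> carrier (Hom K (Tm X n) C)"
    using distinguishedD(2)[OF X, of n] by (simp add: C_def)
  have \<delta>: "\<delta> \<in> carrier (Ext K C A)" using distinguishedD(3)[OF X] by (simp add: A_def C_def)
  have \<eta>: "\<eta> \<in> carrier (Ext K C B)" using \<eta> by (simp add: C_def)
  obtain S i1 i2 p1 p2 where bi: "biproduct K A B S i1 i2 p1 p2"
    using biproduct_exists[OF A B] by blast
  have S: "S \<in> Obj K" and i1: "i1 \<in> carrier (Hom K A S)" and i2: "i2 \<in> carrier (Hom K B S)"
    and p1: "p1 \<in> carrier (Hom K S A)" and p2: "p2 \<in> carrier (Hom K S B)"
    and pi: "p1 \<cdot> i1 = Idm K A" "p2 \<cdot> i2 = Idm K B"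
      "p1 \<cdot> i2 = \<one>\<^bsub>Hom K B A\<^esub>" "p2 \<cdot> i1 = \<one>\<^bsub>Hom K A B\<^esub>"
    using bi by (auto simp: biproduct_def)
  interpret EA: comm_group "Ext K C A" using ext_comm_group C A .
  interpret EB: comm_group "Ext K C B" using ext_comm_group C B .
  interpret ES: comm_group "Ext K C S" using ext_comm_group C S .
  interpret ESn: comm_group "Ext K (Tm X n) S" using ext_comm_group Xn S .
  define \<rho> where "\<rho> = push K C i1 \<delta> \<otimes>\<^bsub>Ext K C S\<^esub> push K C i2 \<eta>"
  note c1 = push_closed[OF C A S i1 \<delta>] and c2 = push_closed[OF C B S i2 \<eta>]
  have \<rho>: "\<rho> \<in> carrier (Ext K C S)" using c1 c2 by (simp add: \<rho>_def)
  have \<rho>1: "push K C p1 \<rho> = \<delta>"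
    unfolding \<rho>_def push_mult[OF C S A p1 c1 c2]
      push_comp[OF C A S A i1 p1 \<delta>, symmetric] push_comp[OF C B S A i2 p1 \<eta>, symmetric] pi
      push_id[OF C A \<delta>] push_zero[OF C B A \<eta>] using \<delta> by simp
  have \<rho>2: "push K C p2 \<rho> = \<eta>"
    unfolding \<rho>_def push_mult[OF C S B p2 c1 c2]
      push_comp[OF C A S B i1 p2 \<delta>, symmetric] push_comp[OF C B S B i2 p2 \<eta>, symmetric] pi
      push_id[OF C B \<eta>] push_zero[OF C A B \<delta>] using \<eta> by simp
  have "pull K A (Df X n) \<delta> = \<one>\<^bsub>Ext K (Tm X n) A\<^esub>"
    using pull_deflation[OF X] by (simp add: A_def)
  then have \<rho>0: "pull K S (Df X n) \<rho> = \<one>\<^bsub>Ext K (Tm X n) S\<^esub>"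
    unfolding \<rho>_def pull_mult[OF C Xn S dX c1 c2]
      pull_push[OF C Xn A S dX i1 \<delta>] pull_push[OF C Xn B S dX i2 \<eta>]
      push_pull[OF C Xn A S dX i1 \<delta>, symmetric] push_pull[OF C Xn B S dX i2 \<eta>, symmetric]
    using kill push_one[OF Xn A S i1] push_one[OF Xn B S i2] by simp
  obtain V where V: "Tm V 0 = S" "Tm V (n + 1) = C" "distinguished n K V \<rho>"
    using realization[OF C S \<rho>] by blast
  have V1: "Tm V 1 \<in> Obj K" using distinguishedD(1)[OF V(3), of 1] by simp
  have dV: "Df V 0 \<in> carrier (Hom K S (Tm V 1))" using distinguishedD(2)[OF V(3), of 0] V by simp
  \<comment> \<open>Pushing \<rho> along \<open>p1\<close> gives \<delta>; hence the lift runs from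
    \<open>V\<close> to \<open>X\<close>, and \<open>V\<close> is the source in the cocone.\<close>
  obtain f N where f: "f 0 = p1" and cocone: "mapping_cocone n K V X f N"
    and N: "distinguished n K N (pull K S (Df X n) \<rho>)"
    using EA2_op[OF S A C \<rho> p1 V(3,1,2) _ A_def[symmetric] C_def[symmetric]] X \<rho>1 by metis
  obtain j1 j2 q1 q2
    where "\<forall>i\<in>{1..n}. biproduct K (Tm X (i - 1)) (Tm V i) (Tm N i) (j1 i) (j2 i) (q1 i) (q2 i)"
    and N0: "Tm N 0 = S" and Ne: "Tm N (n + 1) = Tm X n"
    and dN: "Df N 0 = (j1 1 \<cdot> p1) \<otimes>\<^bsub>Hom K S (Tm N 1)\<^esub> (j2 1 \<cdot> Df V 0)"
    using cocone unfolding mapping_cocone_def f V(1) by (elim exE conjE, intro that) simp_all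
  \<comment> \<open>The first middle term of the cocone is X_0 \<oplus> V_1, with X_0 = A coming
    from the index shift \<open>i - 1\<close> at \<open>i = 1\<close>.\<close>
  then have "biproduct K A (Tm V 1) (Tm N 1) (j1 1) (j2 1) (q1 1) (q2 1)"
    using n_pos by (auto simp: A_def dest: bspec[of _ _ 1])
  then have N1: "Tm N 1 \<in> Obj K" and j1: "j1 1 \<in> carrier (Hom K A (Tm N 1))"
    and j2: "j2 1 \<in> carrier (Hom K (Tm V 1) (Tm N 1))"
    by (auto simp: biproduct_def)
  \<comment> \<open>As the extension of \<open>N\<close> is 0, every morphism out of
    \<open>S\<close> extends along its inflation; here the projection to \<open>B\<close> is
    extended.\<close>
  obtain g where g: "g \<in> carrier (Hom K (Tm N 1) B)" and p2g: "p2 = g \<cdot> Df N 0"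
    using factor_through_inflation[OF N B] p2 \<rho>0 push_one[OF Xn S B p2] N0 Ne by auto
  define u v where "u = g \<cdot> j1 1" and "v = g \<cdot> j2 1"
  have u: "u \<in> carrier (Hom K A B)" unfolding u_def using comp_closed[OF A N1 B j1 g] .
  have v: "v \<in> carrier (Hom K (Tm V 1) B)" unfolding v_def using comp_closed[OF V1 N1 B j2 g] .
  have p2_eq: "p2 = (u \<cdot> p1) \<otimes>\<^bsub>Hom K S B\<^esub> (v \<cdot> Df V 0)"
    unfolding p2g dN u_def v_def
      comp_add_right[OF S N1 B comp_closed[OF S A N1 p1 j1] comp_closed[OF S V1 N1 dV j2] g]
      comp_assoc[OF S A N1 B p1 j1 g] comp_assoc[OF S V1 N1 B dV j2 g] ..
  have "\<eta> = push K C (u \<cdot> p1) \<rho> \<otimes>\<^bsub>Ext K C B\<^esub> push K C (v \<cdot> Df V 0) \<rho>"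
    using emap_add_right[OF C C S B id_closed[OF C] comp_closed[OF S A B p1 u]
        comp_closed[OF S V1 B dV v] \<rho>] \<rho>2 p2_eq by (simp add: push_def)
  also have "push K C (u \<cdot> p1) \<rho> = push K C u \<delta>"
    using push_comp[OF C S A B p1 u \<rho>] \<rho>1 by simp
  also have "push K C (v \<cdot> Df V 0) \<rho> = \<one>\<^bsub>Ext K C B\<^esub>"
    using push_comp[OF C S V1 B dV v \<rho>] push_inflation[OF V(3)] V(2) push_one[OF C V1 B v] by simp
  finally have "\<eta> = push K C u \<delta>" using push_closed[OF C A B u \<delta>] by simp
  with u show ?thesis by (auto simp: A_def C_def)
qed

section \<open>Phantom morphisms and special precovers\<close>

text \<open>Computing \<open>EMap K m e \<delta>\<close> as a pullback followed by a pushforward,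
  the phantom \<open>m\<close> first moves \<delta> into \<open>F\<close>, where \<open>e\<close>
  acts as zero.\<close>

lemma inj_morphisms_subset_right_perp_Ph: "inj_morphisms K F \<subseteq> right_perp K (Ph K F)"
proof
  fix e assume "e \<in> inj_morphisms K F"
  then obtain A B where A: "A \<in> Obj K" and B: "B \<in> Obj K" and e: "e \<in> carrier (Hom K A B)"
    and kill: "\<And>C \<delta>. C \<in> Obj K \<Longrightarrow> \<delta> \<in> F C A \<Longrightarrow> push K C e \<delta> = \<one>\<^bsub>Ext K C B\<^esub>"
    by (auto simp: inj_morphisms_def)
  have "EMap K m e \<delta> = \<one>\<^bsub>Ext K X B\<^esub>"
    if X: "X \<in> Obj K" and C: "C \<in> Obj K" and m: "m \<in> Ph K F" "m \<in> carrier (Hom K X C)"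
      and \<delta>: "\<delta> \<in> carrier (Ext K C A)" for X C m \<delta>
  proof -
    \<comment> \<open>The ends of \<open>m\<close> are existentially bound in \<open>Ph\<close>;
      disjointness of the hom-sets identifies them with \<open>X\<close> and
      \<open>C\<close>.\<close>
    have "pull K A m \<delta> \<in> F X A"
      using m hom_disjoint[OF _ _ X C _ m(2)] A \<delta> by (auto simp: Ph_def)
    then show ?thesis
      using kill[OF X] push_pull[OF C X A B m(2) e \<delta>] by simp
  qed
  with A B e show "e \<in> right_perp K (Ph K F)" unfolding right_perp_def by blast
qed

lemma special_precovering_Ph:
  assumes F: "additive_subfunctor K F" and inj: "enough_injective_morphisms n K F"
    and proj: "enough_projective_morphisms n K"
  shows "special_precovering n K (Ph K F)"
  unfolding special_precovering_def
proof
  fix C assume C: "C \<in> Obj K"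
  obtain X \<delta> where X: "distinguished n K X \<delta>" and XC: "Tm X (n + 1) = C"
    and p: "projective_morphism K (Tm X n) C (Df X n)"
    using proj C unfolding enough_projective_morphisms_def by metis
  define A where "A = Tm X 0"
  have A: "A \<in> Obj K" using distinguishedD(1)[OF X] by (simp add: A_def)
  have \<delta>: "\<delta> \<in> carrier (Ext K C A)" using distinguishedD(3)[OF X] XC by (simp add: A_def)
  \<comment> \<open>The injective morphism is chosen out of \<open>A\<close>, the initial term of
    the projective exangle, so that \<delta> can be pushed along it.\<close>
  obtain Z \<gamma> where Z: "distinguished n K Z \<gamma>" and ZA: "Tm Z 0 = A"
    and \<gamma>: "\<gamma> \<in> F (Tm Z (n + 1)) A" and e_inj: "Df Z 0 \<in> inj_morphisms K F"
    using inj A unfolding enough_injective_morphisms_def by metis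
  have Z1: "Tm Z 1 \<in> Obj K" and Ze: "Tm Z (n + 1) \<in> Obj K"
    using distinguishedD(1)[OF Z] by auto
  have e: "Df Z 0 \<in> carrier (Hom K A (Tm Z 1))" using distinguishedD(2)[OF Z, of 0] ZA by simp
  obtain Y where Y0: "Tm Y 0 = Tm Z 1" and Ye: "Tm Y (n + 1) = C"
    and Y: "distinguished n K Y (push K C (Df Z 0) \<delta>)"
    using realization[OF C Z1 push_closed[OF C A Z1 e \<delta>]] by blast
  have Yn: "Tm Y n \<in> Obj K" using distinguishedD(1)[OF Y] by simp
  define i where "i = Df Y n"
  have i: "i \<in> carrier (Hom K (Tm Y n) C)" using distinguishedD(2)[OF Y, of n] Ye by (simp add: i_def)
  \<comment> \<open>After interchanging the two operations, this says that the deflation of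
    \<open>Y\<close> kills the extension realized by \<open>Y\<close>.\<close>
  have "push K (Tm Y n) (Df Z 0) (pull K A i \<delta>) = \<one>\<^bsub>Ext K (Tm Y n) (Tm Z 1)\<^esub>"
    using pull_deflation[OF Y] push_pull[OF C Yn A Z1 i e \<delta>] pull_push[OF C Yn A Z1 i e \<delta>]
    by (simp add: Y0 i_def)
  then obtain c where "c \<in> carrier (Hom K (Tm Y n) (Tm Z (n + 1)))" "pull K A i \<delta> = pull K A c \<gamma>"
    using push_inflation_eq_one_imp_pull[OF Z Yn] pull_closed[OF C Yn A i \<delta>] by (auto simp: ZA)
  \<comment> \<open>\<open>F\<close> contains \<gamma> and is stable under pullback.\<close>
  then have iF: "pull K A i \<delta> \<in> F (Tm Y n) A"
    using F \<gamma> Ze Yn A unfolding additive_subfunctor_def by metis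
  have "pull K B i \<eta> \<in> F (Tm Y n) B" if B: "B \<in> Obj K" and \<eta>: "\<eta> \<in> carrier (Ext K C B)" for B \<eta>
  proof -
    have "pull K B (Df X n) \<eta> = \<one>\<^bsub>Ext K (Tm X n) B\<^esub>"
      using p B \<eta> by (simp add: projective_morphism_def)
    then obtain g where g: "g \<in> carrier (Hom K A B)" and \<eta>_eq: "\<eta> = push K C g \<delta>"
      using pull_deflation_eq_one_imp_push[OF X B] \<eta> unfolding XC A_def by blast
    have "pull K B i \<eta> = push K (Tm Y n) g (pull K A i \<delta>)"
      unfolding \<eta>_eq push_pull[OF C Yn A B i g \<delta>] by (rule pull_push[OF C Yn A B i g \<delta>])
    then show ?thesis
      using F iF g Yn A B by (simp add: additive_subfunctor_def)
  qed
  then have "i \<in> Ph K F" using Yn C i by (auto simp: Ph_def)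
  moreover have "Df Z 0 \<in> right_perp K (Ph K F) \<inter> carrier (Hom K A (Tm Z 1))"
    using e_inj e inj_morphisms_subset_right_perp_Ph by blast
  ultimately have "special_precover n K (Ph K F) C i"
    unfolding special_precover_def using A Z1 \<delta> Y0 Ye Y i_def by blast
  then show "\<exists>i. special_precover n K (Ph K F) C i" ..
qed

end

theorem theorem4p4:
  fixes n :: nat and K :: "('o, 'm, 'e, 'z) exdata_scheme" and I :: "'m set"
  assumes "n_exangulated_category n K"
    and "enough_projective_morphisms n K"
    and "is_ideal K I"
    and "\<exists>F. additive_subfunctor K F \<and> enough_injective_morphisms n K F \<and> I = Ph K F"
  shows "special_precovering n K I"
  using assms(2,4) n_exangulated_category.special_precovering_Ph[OF assms(1)] by blast

end
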